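(* Let $G=(U,V,E)$ be an instance of the action-reward query-commit matching problem and let $\mathrm{LP}(G)$ be the optimal value of the linear program (LP-C) defined below. Then $\mathrm{OPT}(G)\le \mathrm{LP}(G)$.
   Context: Instance: bipartite graph $G=(U,V,E)$, finite action set $\mathcal{A}$, success probabilities $q_e(a)\in[0,1]$, rewards $r_e(a)\ge0$ ($e\in E,a\in\mathcal{A}$), patience $\ell_s\in\{1,2,\dots\}\cup\{\infty\}$ for $s\in U\cup V$. A policy repeatedly and adaptively picks an edge $e$ and action $a$ and queries $e$ via $a$, revealing an independent $Q_e(a)\sim\mathrm{Ber}(q_e(a))$; if $Q_e(a)=1$, $e$ must be added to the matching and $r_e(a)$ is earned, otherwise $e$ is discarded. Each edge is queried via at most one action, each vertex $s$ has at most $\ell_s$ incident queries, and the output is a matching. $\mathrm{OPT}(G)$ is the maximum expected reward over all policies. For $s\in U\cup V$, $\partial(s)$ is the set of edges incident to $s$. For $v\in V$, $\mathcal{C}_v$ is the set of pairs $(\boldsymbol e,\boldsymbol a)$ where $\boldsymbol e=(e_1,\dots,e_k)$ is a sequence of distinct edges of $\partial(v)$ with $k\le\ell_v$ and $\boldsymbol a=(a_1,\dots,a_k)\in\mathcal{A}^k$; set $\mathrm{val}(\boldsymbol e,\boldsymbol a)=\sum_{i=1}^k r_{e_i}(a_i)q_{e_i}(a_i)\prod_{j<i}(1-q_{e_j}(a_j))$. (LP-C) has variables $z_v(\boldsymbol e,\boldsymbol a)\ge0$ for $v\in V$, $(\boldsymbol e,\boldsymbol a)\in\mathcal{C}_v$,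 and is: maximize $\sum_{v\in V}\sum_{(\boldsymbol e,\boldsymbol a)\in\mathcal{C}_v}\mathrm{val}(\boldsymbol e,\boldsymbol a)z_v(\boldsymbol e,\boldsymbol a)$ subject to, for every $u\in U$: $\sum_{v\in V}\sum_{i,(\boldsymbol e,\boldsymbol a)\in\mathcal{C}_v: e_i=(u,v)} q_{(u,v)}(a_i)\prod_{j<i}(1-q_{e_j}(a_j))\,z_v(\boldsymbol e,\boldsymbol a)\le 1$ and $\sum_{v\in V}\sum_{i,(\boldsymbol e,\boldsymbol a)\in\mathcal{C}_v: e_i=(u,v)}\prod_{j<i}(1-q_{e_j}(a_j))\,z_v(\boldsymbol e,\boldsymbol a)\le \ell_u$; and for every $v\in V$: $\sum_{(\boldsymbol e,\boldsymbol a)\in\mathcal{C}_v}z_v(\boldsymbol e,\boldsymbol a)\le1$. *)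

theory Defs
  imports "HOL-Probability.Probability"
begin

text \<open>
  An edge is a pair \<open>(u, v)\<close> with \<open>u\<close> on the left and \<open>v\<close> on the right side.
\<close>

record ('v, 'a) qc_graph =
  left :: "'v set"
  right :: "'v set"
  edges :: "('v \<times> 'v) set"
  actions :: "'a set"
  prob :: "'v \<times> 'v \<Rightarrow> 'a \<Rightarrow> real"
  rew :: "'v \<times> 'v \<Rightarrow> 'a \<Rightarrow> real"
  patience :: "'v \<Rightarrow> enat"

definition qc_instance :: "('v, 'a) qc_graph \<Rightarrow> bool" where
  "qc_instance G \<longleftrightarrow>
     finite (left G) \<and> finite (right G) \<and> left G \<inter> right G = {} \<and>
     edges G \<subseteq> left G \<times> right G \<and>
     finite (actions G) \<and>
     (\<forall>e\<in>edges G. \<forall>a\<in>actions G. 0 \<le> prob G e a \<and> prob G e a \<le> 1) \<and>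
     (\<forall>e\<in>edges G. \<forall>a\<in>actions G. 0 \<le> rew G e a) \<and>
     (\<forall>s\<in>left G \<union> right G. 1 \<le> patience G s)"

definition incident :: "('v, 'a) qc_graph \<Rightarrow> 'v \<Rightarrow> ('v \<times> 'v) set" where
  "incident G s = {e \<in> edges G. fst e = s \<or> snd e = s}"

definition is_matching :: "('v, 'a) qc_graph \<Rightarrow> ('v \<times> 'v) set \<Rightarrow> bool" where
  "is_matching G M \<longleftrightarrow> M \<subseteq> edges G \<and>
     (\<forall>e\<in>M. \<forall>f\<in>M. e \<noteq> f \<longrightarrow> fst e \<noteq> fst f \<and> snd e \<noteq> snd f)"


section \<open>Policies\<close>

text \<open>
  A deterministic adaptive policy is a decision tree: \<open>Query e a S F\<close> queries \<open>e\<close> via \<open>a\<close> and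
  continues with \<open>S\<close> if the query succeeds and with \<open>F\<close> if it fails. Since no edge may be queried
  twice, every policy stops after at most \<open>card (edges G)\<close> queries, so finite trees suffice.
\<close>

datatype ('v, 'a) dpolicy =
    Stop
  | Query "'v \<times> 'v" 'a "('v, 'a) dpolicy" "('v, 'a) dpolicy"

text \<open>The joint law of the independent Bernoulli variables, indexed by pairs \<open>(e, a)\<close>.\<close>

definition outcomes :: "('v, 'a) qc_graph \<Rightarrow> (('v \<times> 'v) \<times> 'a \<Rightarrow> bool) pmf" where
  "outcomes G = Pi_pmf (edges G \<times> actions G) False (\<lambda>(e, a). bernoulli_pmf (prob G e a))"

primrec queries :: "('v, 'a) dpolicy \<Rightarrow> (('v \<times> 'v) \<times> 'a \<Rightarrow> bool) \<Rightarrow> (('v \<times> 'v) \<times> 'a) list" where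
  "queries Stop Q = []"
| "queries (Query e a S F) Q = (e, a) # (if Q (e, a) then queries S Q else queries F Q)"

definition matched :: "('v, 'a) dpolicy \<Rightarrow> (('v \<times> 'v) \<times> 'a \<Rightarrow> bool) \<Rightarrow> ('v \<times> 'v) set" where
  "matched T Q = {e. \<exists>a. (e, a) \<in> set (queries T Q) \<and> Q (e, a)}"

definition reward :: "('v, 'a) qc_graph \<Rightarrow> ('v, 'a) dpolicy \<Rightarrow> (('v \<times> 'v) \<times> 'a \<Rightarrow> bool) \<Rightarrow> real" where
  "reward G T Q = (\<Sum>(e, a)\<leftarrow>queries T Q. if Q (e, a) then rew G e a else 0)"

text \<open>The constraints are imposed on every realisation of positive probability.\<close>

definition valid_dpolicy :: "('v, 'a) qc_graph \<Rightarrow> ('v, 'a) dpolicy \<Rightarrow> bool" where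
  "valid_dpolicy G T \<longleftrightarrow> (\<forall>Q\<in>set_pmf (outcomes G).
     set (queries T Q) \<subseteq> edges G \<times> actions G \<and>
     distinct (map fst (queries T Q)) \<and>
     (\<forall>s\<in>left G \<union> right G.
        enat (length (filter (\<lambda>(e, a). e \<in> incident G s) (queries T Q))) \<le> patience G s) \<and>
     is_matching G (matched T Q))"

text \<open>
  Policies may randomise: a policy is a distribution over decision trees, drawn independently of
  the query outcomes.
\<close>

definition policies :: "('v, 'a) qc_graph \<Rightarrow> ('v, 'a) dpolicy pmf set" where
  "policies G = {P. \<forall>T\<in>set_pmf P. valid_dpolicy G T}"

definition expected_reward :: "('v, 'a) qc_graph \<Rightarrow> ('v, 'a) dpolicy pmf \<Rightarrow> real" where
  "expected_reward G P =
     measure_pmf.expectation (pair_pmf P (outcomes G)) (\<lambda>(T, Q). reward G T Q)"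

text \<open>Optimal values are suprema in \<^typ>\<open>ereal\<close>, where suprema always exist.\<close>

definition OPT :: "('v, 'a) qc_graph \<Rightarrow> ereal" where
  "OPT G = (SUP P\<in>policies G. ereal (expected_reward G P))"


section \<open>The configuration linear program\<close>

definition configs :: "('v, 'a) qc_graph \<Rightarrow> 'v \<Rightarrow> (('v \<times> 'v) list \<times> 'a list) set" where
  "configs G v = {(es, as). distinct es \<and> set es \<subseteq> incident G v \<and>
     enat (length es) \<le> patience G v \<and> length as = length es \<and> set as \<subseteq> actions G}"

text \<open>Indices are 0-based: the probability that the queries before position \<open>i\<close> all fail.\<close>

definition reach :: "('v, 'a) qc_graph \<Rightarrow> ('v \<times> 'v) list \<Rightarrow> 'a list \<Rightarrow> nat \<Rightarrow> real" where
  "reach G es as i = (\<Prod>j<i. 1 - prob G (es ! j) (as ! j))"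

definition config_val :: "('v, 'a) qc_graph \<Rightarrow> ('v \<times> 'v) list \<Rightarrow> 'a list \<Rightarrow> real" where
  "config_val G es as =
     (\<Sum>i<length es. rew G (es ! i) (as ! i) * prob G (es ! i) (as ! i) * reach G es as i)"

definition lp_feasible ::
  "('v, 'a) qc_graph \<Rightarrow> ('v \<Rightarrow> ('v \<times> 'v) list \<times> 'a list \<Rightarrow> real) set" where
  "lp_feasible G = {z.
     (\<forall>v\<in>right G. \<forall>c\<in>configs G v. 0 \<le> z v c) \<and>
     (\<forall>u\<in>left G.
        (\<Sum>v\<in>right G. \<Sum>(es, as)\<in>configs G v. \<Sum>i | i < length es \<and> es ! i = (u, v).
           prob G (u, v) (as ! i) * reach G es as i * z v (es, as)) \<le> 1) \<and>
     (\<forall>u\<in>left G.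
        ereal (\<Sum>v\<in>right G. \<Sum>(es, as)\<in>configs G v. \<Sum>i | i < length es \<and> es ! i = (u, v).
           reach G es as i * z v (es, as)) \<le> ereal_of_enat (patience G u)) \<and>
     (\<forall>v\<in>right G. (\<Sum>c\<in>configs G v. z v c) \<le> 1)}"

definition lp_objective ::
  "('v, 'a) qc_graph \<Rightarrow> ('v \<Rightarrow> ('v \<times> 'v) list \<times> 'a list \<Rightarrow> real) \<Rightarrow> real" where
  "lp_objective G z =
     (\<Sum>v\<in>right G. \<Sum>(es, as)\<in>configs G v. config_val G es as * z v (es, as))"

definition LP :: "('v, 'a) qc_graph \<Rightarrow> ereal" where
  "LP G = (SUP z\<in>lp_feasible G. ereal (lp_objective G z))"

end

theory Submission
  imports Defs
begin

text \<open>
  Fix a decision tree and a right vertex \<open>v\<close>. Running the tree while pretending that every query at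
  \<open>v\<close> fails yields a random sequence of queries at \<open>v\<close>, and the law of this sequence is the LP
  solution \<open>z\<^sub>v\<close>. Weighting position \<open>i\<close> by the probability that the earlier entries fail recovers
  the law of the real run up to the first success at \<open>v\<close>; afterwards a valid policy earns nothing
  more at \<open>v\<close>. Hence the LP objective equals the expected reward, while the left-hand sides of the
  constraints at \<open>u\<close> are bounded by the expected numbers of successes and of queries at \<open>u\<close>.
\<close>

section \<open>Histories of a decision tree\<close>

text \<open>Each answer is drawn only when its query is made, so the law of the history follows the
  recursion of the tree.\<close>

primrec run ::
  "(('v \<times> 'v) \<times> 'a \<Rightarrow> real) \<Rightarrow> ('v, 'a) dpolicy \<Rightarrow> ((('v \<times> 'v) \<times> 'a) \<times> bool) list pmf" where
  "run p Stop = return_pmf []"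
| "run p (Query e a S F) = bernoulli_pmf (p (e, a)) \<bind>
     (\<lambda>b. map_pmf ((#) ((e, a), b)) (if b then run p S else run p F))"

lemma queries_fun_upd:
  "x \<notin> set (queries T Q) \<Longrightarrow> queries T (Q(x := b)) = queries T Q"
  by (induction T) (auto split: if_splits)

text \<open>Principle of deferred decisions: the coordinates are independent and none is read twice,
  so drawing all of them in advance gives the same history as drawing each on demand. The induction
  removes from \<open>A\<close> the coordinate read at the root.\<close>

lemma map_queries_Pi_pmf_eq_run:
  assumes "finite A"
    and "\<And>Q. Q \<in> set_pmf (Pi_pmf A False (\<lambda>x. bernoulli_pmf (p x))) \<Longrightarrow>
           set (queries T Q) \<subseteq> A \<and> distinct (queries T Q)"
  shows "map_pmf (\<lambda>Q. map (\<lambda>x. (x, Q x)) (queries T Q))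
           (Pi_pmf A False (\<lambda>x. bernoulli_pmf (p x))) = run p T"
  using assms
proof (induction T arbitrary: A)
  case Stop
  then show ?case by simp
next
  case (Query e a S F)
  define x where "x = (e, a)"
  define P where "P = (\<lambda>B. Pi_pmf B False (\<lambda>x. bernoulli_pmf (p x)))"
  define B where "B = A - {x}"
  have "finite B" "x \<notin> B" using Query.prems(1) by (auto simp: B_def)
  \<comment> \<open>The hypothesis speaks only of outcomes in the support; one such outcome suffices
    to see that the root query lies in \<open>A\<close>.\<close>
  obtain Q0 where "Q0 \<in> set_pmf (P A)" using set_pmf_not_empty by fast
  then have "x \<in> A" using Query.prems(2)[of Q0] by (auto simp: x_def P_def)
  then have A: "A = insert x B" by (auto simp: B_def)
  have PA: "P A = bernoulli_pmf (p x) \<bind> (\<lambda>b. map_pmf (\<lambda>Q. Q(x := b)) (P B))"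
    unfolding A P_def using \<open>finite B\<close> \<open>x \<notin> B\<close>
    by (simp add: Pi_pmf_insert' map_pmf_def)
  \<comment> \<open>Below the root \<open>x\<close> is not read again, so its value is immaterial
    there and the hypothesis passes from \<open>A\<close> to \<open>B\<close>.\<close>
  have sub: "set (queries (if b then S else F) Q) \<subseteq> B \<and> distinct (queries (if b then S else F) Q)
      \<and> queries (if b then S else F) (Q(x := b)) = queries (if b then S else F) Q"
    if b: "b \<in> set_pmf (bernoulli_pmf (p x))" and Q: "Q \<in> set_pmf (P B)" for b Q
  proof -
    let ?T = "if b then S else F"
    have "Q(x := b) \<in> set_pmf (P A)" unfolding PA using b Q by auto
    moreover have "queries (Query e a S F) (Q(x := b)) = x # queries ?T (Q(x := b))"
      by (simp add: x_def)
    ultimately have *: "set (queries ?T (Q(x := b))) \<subseteq> A"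
        "x \<notin> set (queries ?T (Q(x := b)))" "distinct (queries ?T (Q(x := b)))"
      using Query.prems(2)[of "Q(x := b)"] by (simp_all only: P_def) auto
    \<comment> \<open>Writing the old value \<open>Q x\<close> back into \<open>Q(x := b)\<close>
      restores \<open>Q\<close>.\<close>
    from queries_fun_upd[OF *(2), of "Q x"] have "queries ?T (Q(x := b)) = queries ?T Q" by simp
    with * show ?thesis by (auto simp: B_def)
  qed
  have IH: "map_pmf (\<lambda>Q. map (\<lambda>x. (x, Q x)) (queries (if b then S else F) Q)) (P B)
      = (if b then run p S else run p F)" if "b \<in> set_pmf (bernoulli_pmf (p x))" for b
    using Query.IH(1)[of B] Query.IH(2)[of B] sub[OF that] \<open>finite B\<close>
    by (cases b) (simp_all add: P_def)
  have "map_pmf (\<lambda>Q. map (\<lambda>x. (x, Q x)) (queries (Query e a S F) Q)) (P A)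
      = bernoulli_pmf (p x) \<bind> (\<lambda>b. map_pmf ((#) (x, b)) (map_pmf
          (\<lambda>Q. map (\<lambda>x. (x, Q x)) (queries (if b then S else F) Q)) (P B)))"
    unfolding PA map_bind_pmf
  proof (intro bind_pmf_cong refl)
    fix b assume b: "b \<in> set_pmf (bernoulli_pmf (p x))"
    show "map_pmf (\<lambda>Q. map (\<lambda>x. (x, Q x)) (queries (Query e a S F) Q))
            (map_pmf (\<lambda>Q. Q(x := b)) (P B)) =
          map_pmf ((#) (x, b)) (map_pmf
            (\<lambda>Q. map (\<lambda>x. (x, Q x)) (queries (if b then S else F) Q)) (P B))"
      unfolding pmf.map_comp o_def
    proof (intro map_pmf_cong refl)
      fix Q assume Q: "Q \<in> set_pmf (P B)"
      have "x \<notin> set (queries (if b then S else F) Q)" using sub[OF b Q] \<open>x \<notin> B\<close> by auto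
      then have "map (\<lambda>y. (y, (Q(x := b)) y)) (queries (if b then S else F) Q) =
          map (\<lambda>y. (y, Q y)) (queries (if b then S else F) Q)"
        by auto
      moreover have "queries (if b then S else F) (Q(x := b)) = queries (if b then S else F) Q"
        using sub[OF b Q] by simp
      ultimately show "map (\<lambda>y. (y, (Q(x := b)) y)) (queries (Query e a S F) (Q(x := b))) =
          (x, b) # map (\<lambda>y. (y, Q y)) (queries (if b then S else F) Q)"
        by (cases b) (simp_all add: x_def)
    qed
  qed
  also have "\<dots> = run p (Query e a S F)"
    using IH by (auto simp: x_def intro!: bind_pmf_cong)
  finally show ?case by (simp add: P_def)
qed

lemma finite_set_run: "finite (set_pmf (run p T))"
  by (induction T) auto


section \<open>Queries at a fixed right vertex\<close>

text \<open>A query that succeeds surely ends the sequence: the failure branch is then not constrained by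
  validity.\<close>

primrec fail_config ::
  "(('v \<times> 'v) \<times> 'a \<Rightarrow> real) \<Rightarrow> 'v \<Rightarrow> ('v, 'a) dpolicy \<Rightarrow> (('v \<times> 'v) \<times> 'a) list pmf" where
  "fail_config p v Stop = return_pmf []"
| "fail_config p v (Query e a S F) =
     (if snd e = v
      then if p (e, a) = 1 then return_pmf [(e, a)]
           else map_pmf ((#) (e, a)) (fail_config p v F)
      else bernoulli_pmf (p (e, a)) \<bind> (\<lambda>b. if b then fail_config p v S else fail_config p v F))"

lemma finite_set_fail_config: "finite (set_pmf (fail_config p v T))"
  by (induction T) auto

text \<open>Horner form of the position sums in (LP-C), suited to induction over the tree.\<close>

primrec discounted :: "('x \<Rightarrow> real) \<Rightarrow> ('x \<Rightarrow> real) \<Rightarrow> 'x list \<Rightarrow> real" where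
  "discounted p g [] = 0"
| "discounted p g (x # c) = g x + (1 - p x) * discounted p g c"

lemma discounted_eq_sum:
  "discounted p g c = (\<Sum>i<length c. g (c ! i) * (\<Prod>j<i. 1 - p (c ! j)))"
proof (induction c)
  case (Cons x c)
  show ?case
    by (simp add: Cons sum.lessThan_Suc_shift prod.lessThan_Suc_shift sum_distrib_left mult_ac
        del: sum.lessThan_Suc prod.lessThan_Suc)
qed simp

text \<open>The first success at \<open>v\<close> is itself still counted. Letting \<open>w\<close>
  see the answer makes one function serve for rewards, successes and queries.\<close>

fun until_success ::
  "'v \<Rightarrow> (('v \<times> 'v) \<times> 'a \<Rightarrow> bool \<Rightarrow> real) \<Rightarrow> ((('v \<times> 'v) \<times> 'a) \<times> bool) list \<Rightarrow> real" where
  "until_success v w [] = 0"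
| "until_success v w ((x, b) # h) =
     (if snd (fst x) = v then w x b + (if b then 0 else until_success v w h)
      else until_success v w h)"

lemma expectation_bind_bernoulli:
  fixes f :: "'b \<Rightarrow> real"
  assumes "0 \<le> q" "q \<le> 1" "\<And>b. finite (set_pmf (M b))"
  shows "measure_pmf.expectation (bernoulli_pmf q \<bind> M) f =
    q * measure_pmf.expectation (M True) f + (1 - q) * measure_pmf.expectation (M False) f"
proof -
  have "measure_pmf.expectation (bernoulli_pmf q \<bind> M) f =
      (\<Sum>b\<in>UNIV. pmf (bernoulli_pmf q) b *\<^sub>R measure_pmf.expectation (M b) f)"
    using assms by (intro pmf_expectation_bind) auto
  then show ?thesis using assms by (simp add: UNIV_bool)
qed

text \<open>At a query at \<open>v\<close> the factor \<open>1 - p x\<close> is a discount on the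
  left and the probability of the failure branch on the right, while the success branch contributes
  only \<open>w x True\<close>. At any other query both sides average over the same Bernoulli
  variable.\<close>

lemma expectation_discounted_fail_config:
  assumes p: "\<And>x. 0 \<le> p x" "\<And>x. p x \<le> 1"
  shows "measure_pmf.expectation (fail_config p v T)
           (discounted p (\<lambda>x. p x * w x True + (1 - p x) * w x False)) =
         measure_pmf.expectation (run p T) (until_success v w)"
proof (induction T)
  case Stop
  then show ?case by simp
next
  case (Query e a S F)
  define x where "x = (e, a)"
  define g where "g = discounted p (\<lambda>x. p x * w x True + (1 - p x) * w x False)"
  have run: "measure_pmf.expectation (run p (Query e a S F)) (until_success v w) =
      p x * measure_pmf.expectation (run p S) (\<lambda>h. until_success v w ((x, True) # h)) +
      (1 - p x) * measure_pmf.expectation (run p F) (\<lambda>h. until_success v w ((x, False) # h))"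
    using p by (simp add: expectation_bind_bernoulli finite_set_run x_def del: until_success.simps)
  have int: "integrable (measure_pmf (run p U)) f"
    "integrable (measure_pmf (fail_config p v U)) f'" for U and f f' :: "_ \<Rightarrow> real"
    by (simp_all add: integrable_measure_pmf_finite finite_set_run finite_set_fail_config)
  show ?case
  proof (cases "snd e = v")
    case True
    \<comment> \<open>If \<open>p x = 1\<close>, the sequence is cut after \<open>x\<close>, but
      then the tail has coefficient \<open>1 - p x = 0\<close>.\<close>
    have "measure_pmf.expectation (fail_config p v (Query e a S F)) g =
        p x * w x True + (1 - p x) * w x False + (1 - p x) * measure_pmf.expectation (fail_config p v F) g"
      using True int by (simp add: x_def[symmetric] g_def)
    also have "\<dots> = measure_pmf.expectation (run p (Query e a S F)) (until_success v w)"
      unfolding run using True int Query.IH(2) by (simp add: x_def g_def algebra_simps)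
    finally show ?thesis by (simp add: g_def)
  next
    case False
    then show ?thesis
      unfolding run using Query.IH p
      by (simp add: expectation_bind_bernoulli finite_set_fail_config x_def)
  qed
qed

text \<open>Validity constrains only histories of positive probability; this carries it over to the
  simulated sequences. A failure that is not impossible can be followed in a real run. At a sure
  success the real run enters \<open>S\<close> and may query \<open>v\<close> again, hence only a
  prefix.\<close>

lemma fail_config_prefix_run:
  assumes p: "\<And>x. 0 \<le> p x" "\<And>x. p x \<le> 1"
    and "c \<in> set_pmf (fail_config p v T)"
  shows "\<exists>h\<in>set_pmf (run p T). \<exists>d. filter (\<lambda>x. snd (fst x) = v) (map fst h) = c @ d"
  using assms(3)
proof (induction T arbitrary: c)
  case Stop
  then show ?case by simp
next
  case (Query e a S F)
  define x where "x = (e, a)"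
  have 0: "b \<in> set_pmf (bernoulli_pmf (p x)) \<longleftrightarrow> (if b then p x \<noteq> 0 else p x \<noteq> 1)" for b
    using p[of x] by (auto simp: set_pmf_iff)
  have mem: "(x, b) # h \<in> set_pmf (run p (Query e a S F))"
    if "b \<in> set_pmf (bernoulli_pmf (p x))" "h \<in> set_pmf (if b then run p S else run p F)" for b h
    using that unfolding run.simps x_def[symmetric] set_bind_pmf by (intro UN_I[of b]) auto
  consider (sure) "snd e = v" "p x = 1" | (fail) "snd e = v" "p x \<noteq> 1" | (other) "snd e \<noteq> v"
    by blast
  then show ?case
  proof cases
    case sure
    then have "c = [x]" using Query.prems by (simp add: x_def)
    \<comment> \<open>Any continuation serves: its queries at \<open>v\<close> are absorbed by
      \<open>d\<close>.\<close>
    moreover obtain h where "h \<in> set_pmf (run p S)" using set_pmf_not_empty by fast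
    then have "(x, True) # h \<in> set_pmf (run p (Query e a S F))"
      using mem[of True h] 0 sure by simp
    ultimately show ?thesis using sure by (intro bexI) (auto simp: x_def)
  next
    case fail
    then obtain c' where "c = x # c'" "c' \<in> set_pmf (fail_config p v F)"
      using Query.prems by (auto simp: x_def)
    moreover from this Query.IH(2) obtain h d where h: "h \<in> set_pmf (run p F)"
      "filter (\<lambda>x. snd (fst x) = v) (map fst h) = c' @ d" by blast
    then have "(x, False) # h \<in> set_pmf (run p (Query e a S F))"
      using mem[of False h] 0 fail by simp
    ultimately show ?thesis using fail h(2) by (intro bexI) (auto simp: x_def)
  next
    case other
    then obtain b where b: "b \<in> set_pmf (bernoulli_pmf (p x))"
      "c \<in> set_pmf (if b then fail_config p v S else fail_config p v F)"
      using Query.prems by (auto simp: x_def)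
    then obtain h d where h: "h \<in> set_pmf (if b then run p S else run p F)"
      "filter (\<lambda>x. snd (fst x) = v) (map fst h) = c @ d"
      using Query.IH by (cases b) (fastforce+)
    then show ?thesis using mem[OF b(1) h(1)] other by (intro bexI) (auto simp: x_def)
  qed
qed

section \<open>Stopped sums against sums over whole histories\<close>

lemma until_success_le_sum_list:
  assumes "\<And>x b. 0 \<le> w x b"
  shows "until_success v w h \<le> (\<Sum>(x, b)\<leftarrow>h. if snd (fst x) = v then w x b else 0)"
proof (induction h)
  case (Cons y h)
  have "0 \<le> (\<Sum>(x, b)\<leftarrow>h. if snd (fst x) = v then w x b else 0)"
    using assms by (intro sum_list_nonneg) auto
  with Cons assms show ?case by (cases y) auto
qed simp

text \<open>Each queried edge has exactly one right endpoint, so the entries are partitioned by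
  it.\<close>

lemma sum_sum_list_right:
  fixes w :: "('v \<times> 'v) \<times> 'a \<Rightarrow> bool \<Rightarrow> real"
  assumes "finite V" "\<And>x b. (x, b) \<in> set h \<Longrightarrow> snd (fst x) \<in> V"
  shows "(\<Sum>v\<in>V. \<Sum>(x, b)\<leftarrow>h. if snd (fst x) = v then w x b else 0) = (\<Sum>(x, b)\<leftarrow>h. w x b)"
  using assms(2)
proof (induction h)
  case (Cons y h)
  obtain x b where y: "y = (x, b)" by (cases y)
  then have "snd (fst x) \<in> V" using Cons.prems[of x b] by simp
  moreover have "(\<Sum>v\<in>V. \<Sum>(x, b)\<leftarrow>h. if snd (fst x) = v then w x b else 0) = (\<Sum>(x, b)\<leftarrow>h. w x b)"
    using Cons.prems by (intro Cons.IH) auto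
  ultimately show ?case using y assms(1) by (simp add: sum.distrib)
qed simp

text \<open>A matching contains at most one edge at each vertex, so stopping at the first success at \<open>v\<close>
  loses no reward.\<close>

lemma until_success_reward:
  assumes "distinct (map (fst \<circ> fst) h)"
    and "\<And>e f a b. \<lbrakk>((e, a), True) \<in> set h; ((f, b), True) \<in> set h; e \<noteq> f\<rbrakk> \<Longrightarrow> snd e \<noteq> snd f"
  shows "until_success v (\<lambda>x b. if b then r x else 0) h =
    (\<Sum>(x, b)\<leftarrow>h. if snd (fst x) = v then if b then r x else 0 else 0)"
  using assms
proof (induction h)
  case (Cons y h)
  obtain e a b where y: "y = ((e, a), b)" by (metis surj_pair)
  have "until_success v (\<lambda>x b. if b then r x else 0) h =
    (\<Sum>(x, b)\<leftarrow>h. if snd (fst x) = v then if b then r x else 0 else 0)"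
    using Cons.prems(1) by (intro Cons.IH Cons.prems(2)) auto
  \<comment> \<open>After a success at \<open>v\<close> every later entry has a different edge, so
    none at \<open>v\<close> can succeed.\<close>
  moreover have "(\<Sum>(x, b)\<leftarrow>h. if snd (fst x) = v then if b then r x else 0 else 0) = 0"
    if "b" "snd e = v"
  proof -
    have "(if snd (fst (fst z)) = v then if snd z then r (fst z) else 0 else 0) = 0"
      if z: "z \<in> set h" for z
    proof -
      obtain f a' b' where [simp]: "z = ((f, a'), b')" by (metis surj_pair)
      have "e \<noteq> f" using Cons.prems(1) z by (force simp: y)
      then show ?thesis
        using Cons.prems(2)[of e a f a'] z \<open>b\<close> \<open>snd e = v\<close> by (auto simp: y)
    qed
    then show ?thesis by (simp add: case_prod_unfold cong: map_cong)
  qed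
  ultimately show ?case by (auto simp: y)
qed simp

text \<open>Two successes at \<open>u\<close> would be on distinct edges sharing \<open>u\<close>,
  against the matching condition.\<close>

lemma success_count_left_le_1:
  assumes "distinct (map (fst \<circ> fst) h)"
    and "\<And>e f a b. \<lbrakk>((e, a), True) \<in> set h; ((f, b), True) \<in> set h; e \<noteq> f\<rbrakk> \<Longrightarrow> fst e \<noteq> fst f"
  shows "(\<Sum>(x, b)\<leftarrow>h. if b \<and> fst (fst x) = u then 1 else 0 :: real) \<le> 1"
  using assms
proof (induction h)
  case (Cons y h)
  obtain e a b where y: "y = ((e, a), b)" by (metis surj_pair)
  have "(\<Sum>(x, b)\<leftarrow>h. if b \<and> fst (fst x) = u then 1 else 0 :: real) \<le> 1"
    using Cons.prems(1) by (intro Cons.IH Cons.prems(2)) auto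
  moreover have "(\<Sum>(x, b)\<leftarrow>h. if b \<and> fst (fst x) = u then 1 else 0 :: real) = 0"
    if "b" "fst e = u"
  proof -
    have "(if snd z \<and> fst (fst (fst z)) = u then 1 else 0 :: real) = 0"
      if z: "z \<in> set h" for z
    proof -
      obtain f a' b' where [simp]: "z = ((f, a'), b')" by (metis surj_pair)
      have "e \<noteq> f" using Cons.prems(1) z by (force simp: y)
      then show ?thesis
        using Cons.prems(2)[of e a f a'] z \<open>b\<close> \<open>fst e = u\<close> by (auto simp: y)
    qed
    then show ?thesis by (simp add: case_prod_unfold cong: map_cong)
  qed
  ultimately show ?case by (auto simp: y)
qed simp


section \<open>The LP solution of a deterministic policy\<close>

lemma finite_edges: "qc_instance G \<Longrightarrow> finite (edges G)"
  unfolding qc_instance_def by (meson finite_SigmaI finite_subset)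

text \<open>Distinctness bounds the length by the number of edges, even when the patience is
  infinite.\<close>

lemma finite_configs:
  assumes "qc_instance G"
  shows "finite (configs G v)"
proof -
  let ?n = "card (edges G)"
  have fin: "finite (edges G)" "finite (actions G)"
    using assms finite_edges by (auto simp: qc_instance_def)
  have "configs G v \<subseteq> {es. set es \<subseteq> edges G \<and> length es \<le> ?n} \<times>
      {as. set as \<subseteq> actions G \<and> length as \<le> ?n}"
  proof
    fix c assume c: "c \<in> configs G v"
    obtain es as where [simp]: "c = (es, as)" by force
    have *: "distinct es" "set es \<subseteq> edges G" "length as = length es" "set as \<subseteq> actions G"
      using c by (auto simp: configs_def incident_def)
    then have "length es \<le> ?n" using card_mono[OF fin(1) *(2)] distinct_card[OF *(1)] by simp
    with * show "c \<in> {es. set es \<subseteq> edges G \<and> length es \<le> ?n} \<times>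
      {as. set as \<subseteq> actions G \<and> length as \<le> ?n}" by simp
  qed
  then show ?thesis
    by (rule finite_subset) (intro finite_cartesian_product finite_lists_length_le fin)
qed

text \<open>The instance constrains \<^const>\<open>prob\<close> only on \<open>edges G \<times> actions G\<close>.\<close>

definition tprob :: "('v, 'a) qc_graph \<Rightarrow> ('v \<times> 'v) \<times> 'a \<Rightarrow> real" where
  "tprob G x = (if x \<in> edges G \<times> actions G then prob G (fst x) (snd x) else 0)"

lemma tprob_bounds: "qc_instance G \<Longrightarrow> 0 \<le> tprob G x \<and> tprob G x \<le> 1"
  by (auto simp: qc_instance_def tprob_def)

lemma outcomes_eq_tprob:
  assumes "qc_instance G"
  shows "outcomes G = Pi_pmf (edges G \<times> actions G) False (\<lambda>x. bernoulli_pmf (tprob G x))"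
  unfolding outcomes_def
  using assms by (intro Pi_pmf_cong) (auto simp: tprob_def finite_edges qc_instance_def)

lemma finite_set_outcomes:
  assumes "qc_instance G"
  shows "finite (set_pmf (outcomes G))"
proof -
  have "finite (edges G \<times> actions G)" using assms finite_edges by (auto simp: qc_instance_def)
  then show ?thesis
    unfolding outcomes_def by (intro finite_subset[OF set_Pi_pmf_subset'] finite_PiE_dflt) auto
qed

lemma run_eq_map_outcomes:
  assumes "qc_instance G" "valid_dpolicy G T"
  shows "run (tprob G) T = map_pmf (\<lambda>Q. map (\<lambda>x. (x, Q x)) (queries T Q)) (outcomes G)"
proof -
  have "finite (edges G \<times> actions G)" using assms finite_edges by (auto simp: qc_instance_def)
  then show ?thesis
    using assms(2) unfolding outcomes_eq_tprob[OF assms(1)] valid_dpolicy_def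
    by (intro map_queries_Pi_pmf_eq_run[symmetric]) (auto simp: distinct_map)
qed

text \<open>Each history in the support of \<open>run\<close> stems from an outcome in the support
  of \<open>outcomes G\<close>, to which validity applies.\<close>

lemma run_history_valid:
  assumes "qc_instance G" "valid_dpolicy G T" "h \<in> set_pmf (run (tprob G) T)"
  shows "set (map fst h) \<subseteq> edges G \<times> actions G"
    and "distinct (map (fst \<circ> fst) h)"
    and "s \<in> left G \<union> right G \<Longrightarrow>
      enat (length (filter (\<lambda>x. fst x \<in> incident G s) (map fst h))) \<le> patience G s"
    and "\<lbrakk>((e, a), True) \<in> set h; ((f, b), True) \<in> set h; e \<noteq> f\<rbrakk> \<Longrightarrow>
      fst e \<noteq> fst f \<and> snd e \<noteq> snd f"
proof -
  obtain Q where Q: "Q \<in> set_pmf (outcomes G)" "h = map (\<lambda>x. (x, Q x)) (queries T Q)"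
    using assms(3) unfolding run_eq_map_outcomes[OF assms(1,2)] by auto
  have h: "map fst h = queries T Q" "map (fst \<circ> fst) h = map fst (queries T Q)"
    by (simp_all add: Q(2) o_def)
  note v = assms(2)[unfolded valid_dpolicy_def, rule_format, OF Q(1)]
  show "set (map fst h) \<subseteq> edges G \<times> actions G" "distinct (map (fst \<circ> fst) h)"
    using v unfolding h by auto
  show "enat (length (filter (\<lambda>x. fst x \<in> incident G s) (map fst h))) \<le> patience G s"
    if "s \<in> left G \<union> right G"
    using v that unfolding h by (auto simp: case_prod_unfold)
  show "fst e \<noteq> fst f \<and> snd e \<noteq> snd f"
    if "((e, a), True) \<in> set h" "((f, b), True) \<in> set h" "e \<noteq> f"
  proof -
    have "e \<in> matched T Q" "f \<in> matched T Q"
      using that by (auto simp: Q(2) matched_def)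
    then show ?thesis using v \<open>e \<noteq> f\<close> by (auto simp: is_matching_def)
  qed
qed

lemma right_not_fst_edge:
  "\<lbrakk>qc_instance G; v \<in> right G; e \<in> edges G\<rbrakk> \<Longrightarrow> e \<in> incident G v \<longleftrightarrow> snd e = v"
  unfolding qc_instance_def incident_def by force

text \<open>The sequence is a prefix of the queries at \<open>v\<close> in some real history, and
  both distinctness and the patience bound pass to prefixes.\<close>

lemma fail_config_in_configs:
  assumes G: "qc_instance G" and T: "valid_dpolicy G T" and v: "v \<in> right G"
    and c: "c \<in> set_pmf (fail_config (tprob G) v T)"
  shows "(map fst c, map snd c) \<in> configs G v"
proof -
  obtain h d where h: "h \<in> set_pmf (run (tprob G) T)"
    and cd: "filter (\<lambda>x. snd (fst x) = v) (map fst h) = c @ d"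
    using fail_config_prefix_run[OF _ _ c] tprob_bounds[OF G] by blast
  note hv = run_history_valid[OF G T h]
  have "distinct (map fst (map fst h))" using hv(2) by simp
  then have "distinct (map fst (c @ d))"
    unfolding cd[symmetric] by (rule distinct_map_filter)
  moreover have sub: "set c \<subseteq> {x \<in> set (map fst h). snd (fst x) = v}"
    using arg_cong[OF cd, of set] by auto
  moreover have "filter (\<lambda>x. fst x \<in> incident G v) (map fst h) = c @ d"
    unfolding cd[symmetric] using hv(1) right_not_fst_edge[OF G v]
    by (intro filter_cong) auto
  then have "enat (length (c @ d)) \<le> patience G v" using hv(3)[of v] v by simp
  then have "enat (length c) \<le> patience G v"
    by (rule order_trans[rotated]) simp
  ultimately show ?thesis
    using hv(1) right_not_fst_edge[OF G v] by (force simp: configs_def)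
qed

definition policy_lp ::
  "('v, 'a) qc_graph \<Rightarrow> ('v, 'a) dpolicy \<Rightarrow> 'v \<Rightarrow> ('v \<times> 'v) list \<times> 'a list \<Rightarrow> real" where
  "policy_lp G T v = pmf (map_pmf (\<lambda>c. (map fst c, map snd c)) (fail_config (tprob G) v T))"

text \<open>Common source of both constraint sums and of the objective, which differ only in
  \<open>w\<close>: the coefficient at a position is the mean of \<open>w\<close> over the answer to
  that query.\<close>

lemma sum_configs_policy_lp:
  assumes G: "qc_instance G" and T: "valid_dpolicy G T" and v: "v \<in> right G"
    and f: "\<And>es as. (es, as) \<in> configs G v \<Longrightarrow> f es as =
      (\<Sum>i<length es. (let x = (es ! i, as ! i) in
        tprob G x * w x True + (1 - tprob G x) * w x False) * reach G es as i)"
  shows "(\<Sum>(es, as)\<in>configs G v. f es as * policy_lp G T v (es, as)) =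
    measure_pmf.expectation (run (tprob G) T) (until_success v w)"
proof -
  let ?g = "\<lambda>x. tprob G x * w x True + (1 - tprob G x) * w x False"
  let ?M = "map_pmf (\<lambda>c. (map fst c, map snd c)) (fail_config (tprob G) v T)"
  have "(\<Sum>(es, as)\<in>configs G v. f es as * policy_lp G T v (es, as)) =
      (\<Sum>c\<in>configs G v. case_prod f c * pmf ?M c)"
    by (simp add: policy_lp_def case_prod_unfold)
  \<comment> \<open>The support of \<open>?M\<close> lies in the finite set of configurations, so
    the sum is an expectation.\<close>
  also have "\<dots> = measure_pmf.expectation ?M (case_prod f)"
    using finite_configs[OF G] fail_config_in_configs[OF G T v]
    by (intro integral_measure_pmf_real[symmetric]) auto
  also have "\<dots> = measure_pmf.expectation (fail_config (tprob G) v T)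
      (\<lambda>c. f (map fst c) (map snd c))"
    by simp
  also have "\<dots> = measure_pmf.expectation (fail_config (tprob G) v T) (discounted (tprob G) ?g)"
  proof (intro integral_cong_AE)
    show "AE c in fail_config (tprob G) v T.
        f (map fst c) (map snd c) = discounted (tprob G) ?g c"
    proof (rule AE_pmfI)
      fix c assume "c \<in> set_pmf (fail_config (tprob G) v T)"
      then have c: "(map fst c, map snd c) \<in> configs G v"
        by (rule fail_config_in_configs[OF G T v])
      have "c ! j \<in> edges G \<times> actions G" if "j < length c" for j
        using c nth_mem[OF that] by (cases "c ! j") (force simp: configs_def incident_def)
      then have "reach G (map fst c) (map snd c) i = (\<Prod>j<i. 1 - tprob G (c ! j))"
        if "i < length c" for i
        unfolding reach_def using that by (intro prod.cong) (auto simp: tprob_def)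
      then show "f (map fst c) (map snd c) = discounted (tprob G) ?g c"
        by (simp add: f[OF c] discounted_eq_sum Let_def)
    qed
  qed simp_all
  also have "\<dots> = measure_pmf.expectation (run (tprob G) T) (until_success v w)"
    using tprob_bounds[OF G] by (intro expectation_discounted_fail_config) auto
  finally show ?thesis .
qed

section \<open>Evaluating the constraints and the objective of the LP\<close>

lemma configs_nth:
  assumes "qc_instance G" "v \<in> right G" "(es, as) \<in> configs G v" "i < length es"
  shows "(es ! i, as ! i) \<in> edges G \<times> actions G" "snd (es ! i) = v"
proof -
  have "es ! i \<in> set es" "as ! i \<in> set as" using assms by (auto simp: configs_def)
  with assms(3) have *: "es ! i \<in> incident G v" "as ! i \<in> actions G" by (auto simp: configs_def)
  then show "(es ! i, as ! i) \<in> edges G \<times> actions G" by (auto simp: incident_def)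
  with * show "snd (es ! i) = v" using right_not_fst_edge[OF assms(1,2)] by auto
qed

lemma sum_expectation_run:
  "(\<Sum>v\<in>V. measure_pmf.expectation (run p T) (f v)) =
    measure_pmf.expectation (run p T) (\<lambda>h. \<Sum>v\<in>V. f v h :: real)"
  by (intro Bochner_Integration.integral_sum[symmetric] integrable_measure_pmf_finite finite_set_run)

lemma expectation_run_le:
  assumes "\<And>h. h \<in> set_pmf (run p T) \<Longrightarrow> f h \<le> (B :: real)"
  shows "measure_pmf.expectation (run p T) f \<le> B"
proof -
  have "measure_pmf.expectation (run p T) f \<le> measure_pmf.expectation (run p T) (\<lambda>_. B)"
    by (intro integral_mono_AE integrable_measure_pmf_finite finite_set_run AE_pmfI assms)
  then show ?thesis by simp
qed

lemma sum_list_indicator_fst: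
  "(\<Sum>(x, b)\<leftarrow>h. if P x then 1 else 0 :: real) = real (length (filter P (map fst h)))"
  by (induction h) auto

lemma history_snd_right:
  assumes "qc_instance G" "valid_dpolicy G T" "h \<in> set_pmf (run (tprob G) T)" "(x, b) \<in> set h"
  shows "fst x \<in> edges G" "snd (fst x) \<in> right G"
proof -
  have "x \<in> edges G \<times> actions G" using run_history_valid(1)[OF assms(1-3)] assms(4) by force
  then show "fst x \<in> edges G" by auto
  then show "snd (fst x) \<in> right G" using assms(1) by (auto simp: qc_instance_def)
qed

text \<open>Summing over \<open>v\<close> inside the expectation reduces each constraint to a bound
  on every single history.\<close>

lemma expectation_until_success_le:
  assumes G: "qc_instance G" and T: "valid_dpolicy G T" and w: "\<And>x b. 0 \<le> w x b"
    and B: "\<And>h. h \<in> set_pmf (run (tprob G) T) \<Longrightarrow> (\<Sum>(x, b)\<leftarrow>h. w x b) \<le> B"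
  shows "(\<Sum>v\<in>right G. measure_pmf.expectation (run (tprob G) T) (until_success v w)) \<le> B"
  unfolding sum_expectation_run
proof (rule expectation_run_le)
  fix h assume h: "h \<in> set_pmf (run (tprob G) T)"
  have "(\<Sum>v\<in>right G. until_success v w h) \<le>
      (\<Sum>v\<in>right G. \<Sum>(x, b)\<leftarrow>h. if snd (fst x) = v then w x b else 0)"
    by (intro sum_mono until_success_le_sum_list w)
  also have "\<dots> = (\<Sum>(x, b)\<leftarrow>h. w x b)"
    using G history_snd_right[OF G T h] by (intro sum_sum_list_right) (auto simp: qc_instance_def)
  finally show "(\<Sum>v\<in>right G. until_success v w h) \<le> B" using B[OF h] by simp
qed

lemma policy_lp_match_sum:
  assumes G: "qc_instance G" and T: "valid_dpolicy G T" and v: "v \<in> right G"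
  shows "(\<Sum>(es, as)\<in>configs G v. \<Sum>i | i < length es \<and> es ! i = (u, v).
      prob G (u, v) (as ! i) * reach G es as i * policy_lp G T v (es, as)) =
    measure_pmf.expectation (run (tprob G) T)
      (until_success v (\<lambda>x b. if b \<and> fst (fst x) = u then 1 else 0))"
  unfolding sum_distrib_right[symmetric]
proof (rule sum_configs_policy_lp[OF G T v])
  fix es as assume c: "(es, as) \<in> configs G v"
  have "(\<Sum>i | i < length es \<and> es ! i = (u, v). prob G (u, v) (as ! i) * reach G es as i) =
    (\<Sum>i<length es. if es ! i = (u, v) then prob G (u, v) (as ! i) * reach G es as i else 0)"
    by (simp add: sum.inter_filter[symmetric])
  \<comment> \<open>The conjuncts \<open>True\<close> and \<open>False\<close> are the two answers
    substituted for \<open>b\<close>; they stay unsimplified to match the rule applied.\<close>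
  also have "\<dots> = (\<Sum>i<length es. (let x = (es ! i, as ! i) in
      tprob G x * (if True \<and> fst (fst x) = u then 1 else 0)
      + (1 - tprob G x) * (if False \<and> fst (fst x) = u then 1 else 0)) * reach G es as i)"
  proof (intro sum.cong refl)
    fix i assume "i \<in> {..<length es}"
    then have i: "(es ! i, as ! i) \<in> edges G \<times> actions G" "snd (es ! i) = v"
      using configs_nth[OF G v c] by auto
    obtain u' where "es ! i = (u', v)" using i(2) by (cases "es ! i") auto
    with i(1) show "(if es ! i = (u, v) then prob G (u, v) (as ! i) * reach G es as i else 0) =
      (let x = (es ! i, as ! i) in
        tprob G x * (if True \<and> fst (fst x) = u then 1 else 0)
        + (1 - tprob G x) * (if False \<and> fst (fst x) = u then 1 else 0)) * reach G es as i"
      by (auto simp: tprob_def)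
  qed
  finally show "(\<Sum>i | i < length es \<and> es ! i = (u, v). prob G (u, v) (as ! i) * reach G es as i) =
    \<dots>" .
qed

text \<open>Here the weight ignores the answer, so its mean is the weight itself and no factor
  \<open>prob\<close> remains.\<close>

lemma policy_lp_query_sum:
  assumes G: "qc_instance G" and T: "valid_dpolicy G T" and v: "v \<in> right G"
  shows "(\<Sum>(es, as)\<in>configs G v. \<Sum>i | i < length es \<and> es ! i = (u, v).
      reach G es as i * policy_lp G T v (es, as)) =
    measure_pmf.expectation (run (tprob G) T)
      (until_success v (\<lambda>x b. if fst (fst x) = u then 1 else 0))"
  unfolding sum_distrib_right[symmetric]
proof (rule sum_configs_policy_lp[OF G T v])
  fix es as assume c: "(es, as) \<in> configs G v"
  have "(\<Sum>i | i < length es \<and> es ! i = (u, v). reach G es as i) =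
    (\<Sum>i<length es. if es ! i = (u, v) then reach G es as i else 0)"
    by (simp add: sum.inter_filter[symmetric])
  also have "\<dots> = (\<Sum>i<length es. (let x = (es ! i, as ! i) in
      tprob G x * (if fst (fst x) = u then 1 else 0)
      + (1 - tprob G x) * (if fst (fst x) = u then 1 else 0)) * reach G es as i)"
    using configs_nth[OF G v c] by (intro sum.cong) (auto simp: prod_eq_iff)
  finally show "(\<Sum>i | i < length es \<and> es ! i = (u, v). reach G es as i) = \<dots>" .
qed

lemma policy_lp_feasible:
  assumes G: "qc_instance G" and T: "valid_dpolicy G T"
  shows "policy_lp G T \<in> lp_feasible G"
  unfolding lp_feasible_def
proof (intro CollectI conjI ballI)
  fix u assume u: "u \<in> left G"
  show "(\<Sum>v\<in>right G. \<Sum>(es, as)\<in>configs G v. \<Sum>i | i < length es \<and> es ! i = (u, v).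
      prob G (u, v) (as ! i) * reach G es as i * policy_lp G T v (es, as)) \<le> 1"
  proof -
    have "(\<Sum>(x, b)\<leftarrow>h. if b \<and> fst (fst x) = u then 1 else 0 :: real) \<le> 1"
      if "h \<in> set_pmf (run (tprob G) T)" for h
      using run_history_valid(2,4)[OF G T that] by (intro success_count_left_le_1) blast+
    then show ?thesis
      by (simp only: policy_lp_match_sum[OF G T] cong: sum.cong)
        (intro expectation_until_success_le[OF G T]; simp)
  qed
  show "ereal (\<Sum>v\<in>right G. \<Sum>(es, as)\<in>configs G v. \<Sum>i | i < length es \<and> es ! i = (u, v).
      reach G es as i * policy_lp G T v (es, as)) \<le> ereal_of_enat (patience G u)"
  proof (cases "patience G u")
    case (enat n)
    have "(\<Sum>(x, b)\<leftarrow>h. if fst (fst x) = u then 1 else 0 :: real) \<le> real n"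
      if h: "h \<in> set_pmf (run (tprob G) T)" for h
    proof -
      have "(\<Sum>(x, b)\<leftarrow>h. if fst (fst x) = u then 1 else 0 :: real) =
          real (length (filter (\<lambda>x. fst (fst x) = u) (map fst h)))"
        by (rule sum_list_indicator_fst)
      \<comment> \<open>A left vertex is never a right endpoint, so incidence with \<open>u\<close>
        means having \<open>u\<close> as first component.\<close>
      also have "filter (\<lambda>x. fst (fst x) = u) (map fst h) =
          filter (\<lambda>x. fst x \<in> incident G u) (map fst h)"
        using u G history_snd_right[OF G T h]
        by (intro filter_cong) (auto simp: incident_def qc_instance_def)
      finally show ?thesis using run_history_valid(3)[OF G T h, of u] u enat by simp
    qed
    then have "(\<Sum>v\<in>right G. \<Sum>(es, as)\<in>configs G v. \<Sum>i | i < length es \<and> es ! i = (u, v).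
        reach G es as i * policy_lp G T v (es, as)) \<le> real n"
      by (simp only: policy_lp_query_sum[OF G T] cong: sum.cong)
        (intro expectation_until_success_le[OF G T]; simp)
    then show ?thesis using enat by simp
  qed simp
next
  fix v assume v: "v \<in> right G"
  show "(\<Sum>c\<in>configs G v. policy_lp G T v c) \<le> 1"
    \<comment> \<open>The sum is the probability that a random configuration lies in
      \<open>configs G v\<close>.\<close>
    unfolding policy_lp_def
    using finite_configs[OF G] by (simp add: measure_measure_pmf_finite[symmetric])
qed (simp add: policy_lp_def)

text \<open>Unlike in the constraints nothing is lost here: failures earn nothing, and the matching
  condition forbids a second success at \<open>v\<close>.\<close>

lemma lp_objective_policy_lp:
  assumes G: "qc_instance G" and T: "valid_dpolicy G T"
  shows "lp_objective G (policy_lp G T) =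
    measure_pmf.expectation (outcomes G) (reward G T)"
proof -
  let ?w = "\<lambda>x b. if b then rew G (fst x) (snd x) else 0"
  have "lp_objective G (policy_lp G T) =
      (\<Sum>v\<in>right G. measure_pmf.expectation (run (tprob G) T) (until_success v ?w))"
    unfolding lp_objective_def
  proof (intro sum.cong refl sum_configs_policy_lp[OF G T])
    fix v es as assume "v \<in> right G" "(es, as) \<in> configs G v"
    from configs_nth(1)[OF G this]
    show "config_val G es as = (\<Sum>i<length es. (let x = (es ! i, as ! i) in
        tprob G x * (if True then rew G (fst x) (snd x) else 0)
        + (1 - tprob G x) * (if False then rew G (fst x) (snd x) else 0)) * reach G es as i)"
      unfolding config_val_def by (intro sum.cong) (auto simp: tprob_def)
  qed
  also have "\<dots> = measure_pmf.expectation (run (tprob G) T) (\<lambda>h. \<Sum>(x, b)\<leftarrow>h. ?w x b)"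
    unfolding sum_expectation_run
  proof (intro integral_cong_AE AE_pmfI)
    fix h assume h: "h \<in> set_pmf (run (tprob G) T)"
    have "(\<Sum>v\<in>right G. until_success v ?w h) =
        (\<Sum>v\<in>right G. \<Sum>(x, b)\<leftarrow>h. if snd (fst x) = v then ?w x b else 0)"
      using run_history_valid(2,4)[OF G T h] by (intro sum.cong refl until_success_reward) blast+
    also have "\<dots> = (\<Sum>(x, b)\<leftarrow>h. ?w x b)"
      using G history_snd_right[OF G T h] by (intro sum_sum_list_right) (auto simp: qc_instance_def)
    finally show "(\<Sum>v\<in>right G. until_success v ?w h) = (\<Sum>(x, b)\<leftarrow>h. ?w x b)" .
  qed simp_all
  also have "\<dots> = measure_pmf.expectation (outcomes G) (reward G T)"
    unfolding run_eq_map_outcomes[OF G T]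
    by (simp add: reward_def[abs_def] o_def case_prod_unfold cong: if_cong)
  finally show ?thesis .
qed

section \<open>From deterministic to randomised policies\<close>

lemma reward_nonneg:
  assumes "qc_instance G" "valid_dpolicy G T" "Q \<in> set_pmf (outcomes G)"
  shows "0 \<le> reward G T Q"
proof -
  have "set (queries T Q) \<subseteq> edges G \<times> actions G"
    using assms(2,3) by (auto simp: valid_dpolicy_def)
  then show ?thesis
    using assms(1) unfolding reward_def by (intro sum_list_nonneg) (auto simp: qc_instance_def)
qed

text \<open>A randomised policy averages deterministic ones. Since \<open>P\<close> may have
  infinite support, the average is computed with nonnegative integrals, which avoids proving
  integrability over the trees.\<close>

lemma valid_expected_reward_le:
  assumes G: "qc_instance G" and P: "P \<in> policies G" and "0 \<le> B"
    and B: "\<And>T. valid_dpolicy G T \<Longrightarrow> measure_pmf.expectation (outcomes G) (reward G T) \<le> B"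
  shows "expected_reward G P \<le> B"
proof -
  have T: "valid_dpolicy G T" if "T \<in> set_pmf P" for T
    using P that by (auto simp: policies_def)
  have "expected_reward G P =
      enn2real (\<integral>\<^sup>+ (T, Q). ennreal (reward G T Q) \<partial>pair_pmf P (outcomes G))"
    unfolding expected_reward_def case_prod_unfold
    by (intro integral_eq_nn_integral AE_pmfI) (auto intro: reward_nonneg[OF G T])
  also have "(\<integral>\<^sup>+ (T, Q). ennreal (reward G T Q) \<partial>pair_pmf P (outcomes G)) =
      (\<integral>\<^sup>+ T. \<integral>\<^sup>+ Q. ennreal (reward G T Q) \<partial>outcomes G \<partial>P)"
    by (simp add: nn_integral_pair_pmf')
  also have "enn2real \<dots> \<le> enn2real (ennreal B)"
  proof (intro enn2real_mono)
    have "(\<integral>\<^sup>+ T. \<integral>\<^sup>+ Q. ennreal (reward G T Q) \<partial>outcomes G \<partial>P) \<le> (\<integral>\<^sup>+ T. ennreal B \<partial>P)"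
    proof (intro nn_integral_mono_AE AE_pmfI)
      fix t assume "t \<in> set_pmf P"
      then have t: "valid_dpolicy G t" by (rule T)
      then have "(\<integral>\<^sup>+ Q. ennreal (reward G t Q) \<partial>outcomes G) =
          ennreal (measure_pmf.expectation (outcomes G) (reward G t))"
        by (intro nn_integral_eq_integral AE_pmfI integrable_measure_pmf_finite
            finite_set_outcomes[OF G] reward_nonneg[OF G])
      also have "\<dots> \<le> ennreal B" by (intro ennreal_leI B t)
      finally show "(\<integral>\<^sup>+ Q. ennreal (reward G t Q) \<partial>outcomes G) \<le> ennreal B" .
    qed
    then show "(\<integral>\<^sup>+ T. \<integral>\<^sup>+ Q. ennreal (reward G T Q) \<partial>outcomes G \<partial>P) \<le> ennreal B" by simp
  qed simp
  finally show ?thesis using \<open>0 \<le> B\<close> by simp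
qed

theorem mainTheorem2:
  fixes G :: "('v, 'a) qc_graph"
  assumes "qc_instance G"
  shows "OPT G \<le> LP G"
proof -
  have det: "ereal (measure_pmf.expectation (outcomes G) (reward G T)) \<le> LP G"
    if "valid_dpolicy G T" for T
    unfolding LP_def lp_objective_policy_lp[OF assms that, symmetric]
    by (intro SUP_upper policy_lp_feasible[OF assms that])
  \<comment> \<open>The empty policy earns 0, which shows that \<open>LP G\<close> is nonnegative
    and so not minus infinity.\<close>
  have "valid_dpolicy G Stop"
    by (simp add: valid_dpolicy_def matched_def is_matching_def zero_enat_def[symmetric])
  from det[OF this] have "0 \<le> LP G" by (simp add: reward_def[abs_def] zero_ereal_def)
  show ?thesis
    unfolding OPT_def
  proof (rule SUP_least)
    fix P assume P: "P \<in> policies G"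
    show "ereal (expected_reward G P) \<le> LP G"
    \<comment> \<open>The averaging bound needs a real number; an infinite \<open>LP G\<close> makes
      the claim trivial.\<close>
    proof (cases "LP G")
      case (real B)
      then have "expected_reward G P \<le> B"
        using det \<open>0 \<le> LP G\<close> by (intro valid_expected_reward_le[OF assms P]) auto
      then show ?thesis using real by simp
    qed (use \<open>0 \<le> LP G\<close> in auto)
  qed
qed

end
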